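(* Let $0<c<1$ be a constant. There is a constant $K=K(c)$ such that for every $n\ge1$ and all real vectors $w=(w_1,\dots,w_n)$, $v=(v_1,\dots,v_n)$ with $m_w\le cn$ and $m_v\le cn$, $$\sup_{x\in\mathbb{R}}\mathbb{P}\Big(\sum_{i=1}^n w_iv_{\pi(i)}=x\Big)\le\frac{K}{n^{1/2}},$$ where $\pi$ is a uniformly random permutation of $\{1,\dots,n\}$.
   Context: For a vector $v=(v_1,\dots,v_n)$, $m_v=\max_a\#\{i:1\le i\le n,\ v_i=a\}$ is the maximum multiplicity of an entry of $v$. *)

theory Defs
  imports "HOL-Probability.Probability" "HOL-Combinatorics.Permutations"
begin

(* A real vector of length n is a function on nat of which only the entries with
   indices 1, ..., n matter.  The maximum ranges over all real a; it is attained,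
   since the cardinalities take only values between 0 and n. *)
definition max_mult :: "nat \<Rightarrow> (nat \<Rightarrow> real) \<Rightarrow> nat" where
  "max_mult n v = Max (range (\<lambda>a. card {i \<in> {1..n}. v i = a}))"

definition random_perm :: "nat \<Rightarrow> (nat \<Rightarrow> nat) pmf" where
  "random_perm n = pmf_of_set {\<pi>. \<pi> permutes {1..n}}"

end

theory Submission
  imports Defs
begin

text \<open>
  Since no value of \<open>w\<close> is taken more than \<open>c n\<close> times, there are at least \<open>(1 - c) n / 2\<close>
  disjoint index pairs \<open>{i, f i}\<close> with \<open>w i \<noteq> w (f i)\<close>. Composing a uniformly random permutation
  \<open>p\<close> with independent random swaps of these pairs does not change its distribution, and turns
  the sum into a random subset sum with coefficients
  \<open>(w i - w (f i)) (v (p (f i)) - v (p i))\<close>. If \<open>N p\<close> of these are nonzero, the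
  Littlewood--Offord inequality bounds the conditional point probabilities by
  \<open>1 / sqrt (N p + 1)\<close>. The multiplicity bound on \<open>v\<close> makes the mean of \<open>N p\<close> linear in \<open>n\<close>,
  its variance is also \<open>O(n)\<close>, and so \<open>1 / sqrt (N p + 1)\<close> averages to \<open>O(1 / sqrt n)\<close>.
\<close>

section \<open>The Littlewood--Offord inequality\<close>

lemma LYM_inequality:
  assumes "finite A" "F \<subseteq> Pow A"
    and anti: "\<And>S T. S \<in> F \<Longrightarrow> T \<in> F \<Longrightarrow> S \<subseteq> T \<Longrightarrow> S = T"
  shows "(\<Sum>S\<in>F. 1 / real (card A choose card S)) \<le> 1"
  using assms
proof (induction "card A" arbitrary: A F rule: less_induct)
  case less
  have finF: "finite F"
    using less.prems(1,2) by (meson finite_Pow_iff finite_subset)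
  show ?case
  proof (cases "A \<in> F")
    case True
    then have "F = {A}"
      using less.prems(2,3) by blast
    then show ?thesis by simp
  next
    case False
    show ?thesis
    proof (cases "A = {}")
      case True
      with False less.prems(2) have "F = {}" by auto
      then show ?thesis by simp
    next
      case ne: False
      \<comment> \<open>Average the induction hypothesis for \<open>A - {x}\<close> over all \<open>x \<in> A\<close>.\<close>
      define n where "n = card A"
      have n0: "n > 0" using ne less.prems(1) by (simp add: n_def card_gt_0_iff)
      have IH: "(\<Sum>S\<in>{S\<in>F. x \<notin> S}. 1 / real ((n - 1) choose card S)) \<le> 1" if "x \<in> A" for x
      proof -
        have "card (A - {x}) = n - 1" using that by (simp add: n_def)
        moreover have "(\<Sum>S\<in>{S\<in>F. x \<notin> S}. 1 / real (card (A - {x}) choose card S)) \<le> 1"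
        proof (rule less.hyps)
          show "card (A - {x}) < card A"
            using that less.prems(1) by (meson card_Diff1_less)
          show "{S\<in>F. x \<notin> S} \<subseteq> Pow (A - {x})"
            using less.prems(2) by auto
        qed (use less.prems in auto)
        ultimately show ?thesis by simp
      qed
      \<comment> \<open>After the exchange of sums, \<open>S\<close> is counted once for each of the
        \<open>n - card S\<close> elements it omits; the identity (n - s) C(n, s) = n C(n - 1, s)
        turns these terms into \<open>n\<close> times its weight in \<open>A\<close>.\<close>
      have term_eq: "(\<Sum>x\<in>A - S. 1 / real ((n - 1) choose card S)) = n * (1 / real (n choose card S))"
        if "S \<in> F" for S
      proof -
        have SA: "S \<subseteq> A" "S \<noteq> A" using that False less.prems(2) by auto
        then have lt: "card S < n"
          unfolding n_def using less.prems(1) by (simp add: psubset_card_mono psubset_eq)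
        have cd: "card (A - S) = n - card S"
          using SA less.prems(1) by (simp add: n_def card_Diff_subset finite_subset)
        have "(n - card S) * (n choose card S) = n * ((n - 1) choose card S)"
          using binomial_absorb_comp[of n "card S"] by simp
        then have "real (n - card S) * real (n choose card S) = real n * real ((n - 1) choose card S)"
          by (metis of_nat_mult)
        moreover have "real (n choose card S) > 0" "real ((n - 1) choose card S) > 0"
          using lt by auto
        ultimately show ?thesis by (simp add: cd field_simps)
      qed
      have "n * (\<Sum>S\<in>F. 1 / real (n choose card S))
          = (\<Sum>S\<in>F. \<Sum>x\<in>A - S. 1 / real ((n - 1) choose card S))"
        unfolding sum_distrib_left by (intro sum.cong refl) (rule term_eq[symmetric])
      also have "\<dots> = (\<Sum>S\<in>F. \<Sum>x\<in>{x\<in>A. x \<notin> S}. 1 / real ((n - 1) choose card S))"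
        by (simp add: set_diff_eq)
      also have "\<dots> = (\<Sum>x\<in>A. \<Sum>S\<in>{S\<in>F. x \<notin> S}. 1 / real ((n - 1) choose card S))"
        using finF less.prems(1) by (rule sum.swap_restrict)
      also have "\<dots> \<le> (\<Sum>x\<in>A. 1)"
        by (rule sum_mono) (use IH in auto)
      also have "\<dots> = n" by (simp add: n_def)
      finally show ?thesis using n0 by (simp add: n_def)
    qed
  qed
qed

text \<open>No binomial coefficient of \<open>card A\<close> exceeds the middle one, so each member
  of \<open>F\<close> contributes at least the reciprocal of the middle one to the LYM sum, which is
  at most 1.\<close>

lemma Sperner:
  assumes "finite A" "F \<subseteq> Pow A"
    and "\<And>S T. S \<in> F \<Longrightarrow> T \<in> F \<Longrightarrow> S \<subseteq> T \<Longrightarrow> S = T"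
  shows "card F \<le> card A choose (card A div 2)"
proof -
  let ?m = "card A choose (card A div 2)"
  have m0: "?m > 0" by simp
  have "card F * (1 / real ?m) = (\<Sum>S\<in>F. 1 / real ?m)"
    by simp
  also have "\<dots> \<le> (\<Sum>S\<in>F. 1 / real (card A choose card S))"
  proof (rule sum_mono)
    fix S assume "S \<in> F"
    then have "card S \<le> card A" using assms(1,2) by (auto intro: card_mono)
    then show "1 / real ?m \<le> 1 / real (card A choose card S)"
      by (intro divide_left_mono) (auto simp: binomial_maximum)
  qed
  also have "\<dots> \<le> 1" using assms by (rule LYM_inequality)
  finally show ?thesis using m0 by (simp add: field_simps)
qed

section \<open>Size of the middle binomial coefficient\<close>

text \<open>This is C(2k, k) \<le> 4^k / sqrt(2k + 1), squared so as to be a statement about natural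
  numbers. Passing from k to k + 1 multiplies the left side by 4 (2k + 1) (2k + 3) / (k + 1)^2, and
  (2k + 1) (2k + 3) < (2k + 2)^2 keeps this factor below 16.\<close>

lemma central_binomial_upper_bound:
  "((2 * k) choose k)\<^sup>2 * (2 * k + 1) \<le> 16 ^ k"
proof (induction k)
  case (Suc k)
  define b where "b = real ((2 * k) choose k)"
  define b' where "b' = real ((2 * Suc k) choose Suc k)"
  have "(2 * Suc k) choose Suc k = 2 * (Suc (2 * k) choose Suc k)"
    using binomial_symmetric[of k "Suc (2 * k)"] by simp
  moreover have "Suc k * (Suc (2 * k) choose Suc k) = Suc (2 * k) * ((2 * k) choose k)"
    using Suc_times_binomial_eq[of "2 * k" k] by (simp only: mult.commute)
  ultimately have "Suc k * ((2 * Suc k) choose Suc k) = 2 * Suc (2*k) * ((2 * k) choose k)"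
    by (simp only: mult.left_commute mult.assoc)
  then have "real (Suc k * ((2 * Suc k) choose Suc k)) = real (2 * Suc (2*k) * ((2 * k) choose k))"
    by (simp only:)
  then have b': "b' = 2 * (2 * k + 1) * b / (k + 1)"
    unfolding b_def b'_def of_nat_mult by (simp add: field_simps)
  have IH: "b\<^sup>2 * (2 * k + 1) \<le> 16 ^ k"
    unfolding b_def using of_nat_mono[OF Suc.IH, where 'a = real] by (simp add: algebra_simps)
  have "b'\<^sup>2 * real (2 * k + 3) = (b\<^sup>2 * (2 * k + 1)) * (4 * (2 * real k + 1) * (2 * real k + 3) / (1 + real k)\<^sup>2)"
    by (simp add: b' power2_eq_square field_simps)
  also have "\<dots> \<le> 16 ^ k * 16"
  proof (rule mult_mono[OF IH])
    have "4 * (2 * real k + 1) * (2 * real k + 3) \<le> 16 * (1 + real k)\<^sup>2"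
      by (simp add: power2_eq_square algebra_simps)
    then show "4 * (2 * real k + 1) * (2 * real k + 3) / (1 + real k)\<^sup>2 \<le> 16"
      by (simp add: pos_divide_le_eq)
  qed auto
  also have "\<dots> = real (16 ^ Suc k)" by simp
  finally have "real (((2 * Suc k) choose Suc k)\<^sup>2 * (2 * k + 3)) \<le> real (16 ^ Suc k)"
    by (simp only: b'_def of_nat_mult of_nat_power)
  moreover have "2 * Suc k + 1 = 2 * k + 3" by simp
  ultimately show ?case by (simp only: of_nat_le_iff)
qed simp

lemma middle_binomial_upper_bound:
  "real (n choose (n div 2)) \<le> 2 ^ n / sqrt (real n + 1)"
proof -
  have even_case: "real ((2 * k) choose k) \<le> 4 ^ k / sqrt (2 * real k + 1)" for k
  proof -
    have "real (((2 * k) choose k)\<^sup>2 * (2 * k + 1)) \<le> real (16 ^ k)"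
      using central_binomial_upper_bound[of k] by (simp only: of_nat_le_iff)
    then have "(real ((2 * k) choose k))\<^sup>2 * (2 * real k + 1) \<le> 16 ^ k"
      by (simp add: algebra_simps)
    moreover have "(4 ^ k)\<^sup>2 = (16 :: real) ^ k"
      by (simp add: power2_eq_square flip: power_mult_distrib)
    ultimately have "(real ((2 * k) choose k) * sqrt (2 * real k + 1))\<^sup>2 \<le> (4 ^ k)\<^sup>2"
      by (simp add: power_mult_distrib)
    then have "real ((2 * k) choose k) * sqrt (2 * real k + 1) \<le> 4 ^ k"
      by (rule power2_le_imp_le) simp
    then show ?thesis by (simp add: field_simps)
  qed
  show ?thesis
  proof (cases "even n")
    case True
    then obtain k where "n = 2 * k" by blast
    then show ?thesis using even_case[of k] by (simp add: power_mult)
  next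
    case False
    then obtain k where n: "n = 2 * k + 1" by (elim oddE)
    \<comment> \<open>For odd \<open>n\<close> the central coefficient of n + 1 is the sum of the
      two equal middle coefficients of \<open>n\<close>, so the even case applies to n + 1.\<close>
    have "Suc n choose Suc k = 2 * (n choose k)"
      using binomial_symmetric[of k n] n by (simp add: mult_2)
    then have "2 * real (n choose k) = real ((2 * Suc k) choose Suc k)"
      using n by simp
    also have "\<dots> \<le> 4 ^ Suc k / sqrt (2 * real (Suc k) + 1)" by (rule even_case)
    also have "\<dots> \<le> 4 ^ Suc k / sqrt (real n + 1)"
      by (intro divide_left_mono) (auto simp: n)
    also have "\<dots> = 2 * (2 ^ n / sqrt (real n + 1))"
      by (simp add: n power_mult)
    finally show ?thesis by (simp add: n)
  qed
qed

section \<open>Subset sums with a prescribed value\<close>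

text \<open>Erdos's argument: when all coefficients are positive, enlarging a set strictly increases
  its sum, so the sets attaining one value form an antichain and Sperner's bound counts
  them.\<close>

lemma Littlewood_Offord_nonzero:
  fixes c :: "'a \<Rightarrow> real"
  assumes fin: "finite A" and nz: "\<And>i. i \<in> A \<Longrightarrow> c i \<noteq> 0"
  shows "real (card {T \<in> Pow A. sum c T = x}) \<le> 2 ^ card A / sqrt (real (card A) + 1)"
proof -
  define N where "N = {i \<in> A. c i < 0}"
  define F where "F = {T \<in> Pow A. sum c T = x}"
  \<comment> \<open>Reflecting in \<open>N\<close> replaces the coefficients by their absolute values, which makes the family an antichain.\<close>
  define h where "h = (\<lambda>T. (T - N) \<union> (N - T))"
  have NA: "N \<subseteq> A" by (auto simp: N_def)
  have inj: "inj_on h F" by (rule inj_onI) (auto simp: h_def)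
  have sum_h: "(\<Sum>i\<in>h T. \<bar>c i\<bar>) = x - sum c N" if "T \<in> F" for T
  proof -
    have TA: "T \<subseteq> A" and sT: "sum c T = x" using that by (auto simp: F_def)
    have finT: "finite T" "finite N" using TA NA fin finite_subset by blast+
    have "(\<Sum>i\<in>h T. \<bar>c i\<bar>) = (\<Sum>i\<in>T - N. \<bar>c i\<bar>) + (\<Sum>i\<in>N - T. \<bar>c i\<bar>)"
      unfolding h_def using finT by (intro sum.union_disjoint) auto
    also have "(\<Sum>i\<in>T - N. \<bar>c i\<bar>) = (\<Sum>i\<in>T - N. c i)"
      using TA by (intro sum.cong) (auto simp: N_def)
    also have "(\<Sum>i\<in>N - T. \<bar>c i\<bar>) = - (\<Sum>i\<in>N - T. c i)"
      unfolding sum_negf[symmetric] by (intro sum.cong) (auto simp: N_def)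
    also have "(\<Sum>i\<in>T - N. c i) = sum c T - sum c (T \<inter> N)"
      using sum.Int_Diff[of T c N] finT by simp
    also have "(\<Sum>i\<in>N - T. c i) = sum c N - sum c (T \<inter> N)"
      using sum.Int_Diff[of N c T] finT by (simp add: Int_commute)
    finally show ?thesis using sT by simp
  qed
  have hA: "h T \<subseteq> A" if "T \<in> F" for T
    using that NA by (auto simp: F_def h_def)
  have "card (h ` F) \<le> card A choose (card A div 2)"
  proof (rule Sperner[OF fin])
    show "h ` F \<subseteq> Pow A" using hA by auto
  next
    fix S T assume "S \<in> h ` F" "T \<in> h ` F" and ST: "S \<subseteq> T"
    then have eq: "(\<Sum>i\<in>S. \<bar>c i\<bar>) = (\<Sum>i\<in>T. \<bar>c i\<bar>)" and TA: "T \<subseteq> A"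
      using sum_h hA by auto
    have finT: "finite T" using TA fin finite_subset by blast
    then have "(\<Sum>i\<in>T - S. \<bar>c i\<bar>) = 0"
      using eq ST by (simp add: sum_diff)
    then have "\<forall>i\<in>T - S. \<bar>c i\<bar> = 0"
      using finT by (subst (asm) sum_nonneg_eq_0_iff) auto
    then show "S = T" using nz TA ST by fastforce
  qed
  then have "real (card F) \<le> real (card A choose (card A div 2))"
    by (simp add: card_image[OF inj])
  also have "\<dots> \<le> 2 ^ card A / sqrt (real (card A) + 1)"
    by (rule middle_binomial_upper_bound)
  finally show ?thesis by (simp add: F_def)
qed

text \<open>Zero coefficients leave the sum unchanged, so a solution consists of a solution inside
  \<open>G\<close> and a free choice inside \<open>Z\<close>. The \<open>2 ^ card Z\<close> choices
  complete \<open>2 ^ card G\<close> to \<open>2 ^ card A\<close>.\<close>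

lemma Littlewood_Offord:
  fixes c :: "'a \<Rightarrow> real"
  assumes fin: "finite A"
  shows "real (card {T \<in> Pow A. sum c T = x}) \<le> 2 ^ card A / sqrt (real (card {i \<in> A. c i \<noteq> 0}) + 1)"
proof -
  define G where "G = {i \<in> A. c i \<noteq> 0}"
  define Z where "Z = {i \<in> A. c i = 0}"
  define F where "F = {T \<in> Pow G. sum c T = x}"
  have fins: "finite G" "finite Z" "finite F"
    using fin by (auto simp: G_def Z_def F_def)
  have card_A: "card A = card Z + card G"
  proof -
    have "A = Z \<union> G" "Z \<inter> G = {}" by (auto simp: G_def Z_def)
    then show ?thesis using fins by (metis card_Un_disjoint)
  qed
  have "{T \<in> Pow A. sum c T = x} \<subseteq> (\<lambda>(T, U). T \<union> U) ` (F \<times> Pow Z)"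
  proof
    fix T assume T: "T \<in> {T \<in> Pow A. sum c T = x}"
    then have finT: "finite T" using fin finite_subset by blast
    have "sum c (T \<inter> G) = sum c T"
      using finT T by (intro sum.mono_neutral_left) (auto simp: G_def)
    then have "(T \<inter> G, T \<inter> Z) \<in> F \<times> Pow Z"
      using T by (auto simp: F_def)
    moreover have "T = (T \<inter> G) \<union> (T \<inter> Z)"
      using T by (auto simp: G_def Z_def)
    ultimately show "T \<in> (\<lambda>(T, U). T \<union> U) ` (F \<times> Pow Z)"
      by (metis (no_types, lifting) case_prod_conv image_eqI)
  qed
  then have "card {T \<in> Pow A. sum c T = x} \<le> card (F \<times> Pow Z)"
    using fins by (intro surj_card_le) auto
  also have "\<dots> = card F * 2 ^ card Z"
    using fins by (simp add: card_cartesian_product card_Pow)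
  finally have "real (card {T \<in> Pow A. sum c T = x}) \<le> real (card F) * 2 ^ card Z"
    using of_nat_mono by fastforce
  also have "\<dots> \<le> 2 ^ card G / sqrt (real (card G) + 1) * 2 ^ card Z"
    unfolding F_def using fins by (intro mult_right_mono Littlewood_Offord_nonzero) (auto simp: G_def)
  also have "\<dots> = 2 ^ card A / sqrt (real (card G) + 1)"
    by (simp add: card_A power_add)
  finally show ?thesis by (simp add: G_def)
qed

section \<open>Random swaps along a matching\<close>

text \<open>Greedy matching: pairs of elements with different values are removed until the rest is
  constant, and \<open>z\<close> is the value on the rest. \<open>A\<close> holds one end of each
  pair and \<open>f\<close> gives the other.\<close>

lemma exists_unequal_matching:
  fixes w :: "'a \<Rightarrow> 'b"
  assumes "finite S"
  shows "\<exists>A f z. A \<subseteq> S \<and> f ` A \<subseteq> S \<and> inj_on f A \<and> A \<inter> f ` A = {} \<and>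
           (\<forall>i\<in>A. w i \<noteq> w (f i)) \<and> card S \<le> 2 * card A + card {i \<in> S. w i = z}"
  using assms
proof (induction "card S" arbitrary: S rule: less_induct)
  case less
  show ?case
  proof (cases "\<exists>z. \<forall>i\<in>S. w i = z")
    case True
    then obtain z where "{i \<in> S. w i = z} = S" by blast
    then have "card S \<le> 2 * card {} + card {i \<in> S. w i = z}" by simp
    then show ?thesis by (intro exI[of _ "{}"] exI[of _ id] exI[of _ z]) auto
  next
    case False
    then obtain x y where xy: "x \<in> S" "y \<in> S" "w x \<noteq> w y" by metis
    then have ne: "x \<noteq> y" by auto
    define S' where "S' = S - {x, y}"
    have "card {x, y} \<le> card S" using xy less.prems by (intro card_mono) auto
    then have card_S: "card S = card S' + 2"
      using xy ne less.prems by (simp add: S'_def card_Diff_subset)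
    obtain A f z where Af: "A \<subseteq> S'" "f ` A \<subseteq> S'" "inj_on f A" "A \<inter> f ` A = {}"
      "\<forall>i\<in>A. w i \<noteq> w (f i)" "card S' \<le> 2 * card A + card {i \<in> S'. w i = z}"
      using less.hyps[of S'] less.prems card_S by (auto simp: S'_def)
    define g where "g = f(x := y)"
    have xA: "x \<notin> A" "x \<notin> f ` A" "y \<notin> A" "y \<notin> f ` A" using Af(1,2) by (auto simp: S'_def)
    have gA: "g i = f i" if "i \<in> A" for i using that xA by (auto simp: g_def)
    have im: "g ` insert x A = insert y (f ` A)" using image_cong[OF refl gA, of A] by (simp add: g_def del: fun_upd_apply) (simp add: g_def)
    have finA: "finite A" using Af(1) less.prems by (auto simp: S'_def intro: finite_subset)
    have "card {i \<in> S'. w i = z} \<le> card {i \<in> S. w i = z}"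
      using less.prems by (intro card_mono) (auto simp: S'_def)
    then have "card S \<le> 2 * card (insert x A) + card {i \<in> S. w i = z}"
      using Af(6) finA xA card_S by simp
    moreover have "inj_on g (insert x A)"
    proof -
      have "inj_on g A" using Af(3) gA by (simp add: inj_on_def)
      moreover have "g x = y" by (simp add: g_def)
      moreover have "g ` A = f ` A" using gA by (rule image_cong[OF refl])
      ultimately show ?thesis using xA by (simp only: inj_on_insert) simp
    qed
    moreover have "\<forall>i\<in>insert x A. w i \<noteq> w (g i)"
      using Af(5) gA xy by (auto simp: g_def)
    moreover have "insert x A \<subseteq> S" "insert x A \<inter> g ` insert x A = {}" "g ` insert x A \<subseteq> S"
      unfolding im using Af xA xy ne by (auto simp: S'_def)
    ultimately show ?thesis by blast
  qed
qed

lemma sum_transpose: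
  fixes w g :: "'a \<Rightarrow> real"
  assumes "finite S" "x \<in> S" "y \<in> S" "x \<noteq> y"
  shows "(\<Sum>i\<in>S. w i * g (Transposition.transpose x y i)) = (\<Sum>i\<in>S. w i * g i) + (w x - w y) * (g y - g x)"
proof -
  have S: "S = insert x (insert y (S - {x, y}))" using assms by auto
  have split: "sum h S = h x + h y + sum h (S - {x, y})" for h :: "'a \<Rightarrow> real"
    using assms by (subst S) simp
  have "(\<Sum>i\<in>S - {x, y}. w i * g (Transposition.transpose x y i)) = (\<Sum>i\<in>S - {x, y}. w i * g i)"
    by (intro sum.cong) (auto simp: Transposition.transpose_def)
  then show ?thesis by (simp add: split algebra_simps)
qed

text \<open>\<open>\<tau>\<close> is the product of the transpositions of \<open>x\<close> and
  \<open>f x\<close> over all \<open>x\<close> in \<open>A\<close>; the pairs being disjoint, their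
  effects on the sum add up. Quantifying over \<open>g\<close> after \<open>\<tau>\<close> lets a
  single \<open>\<tau>\<close> serve all permutations later.\<close>

lemma exists_matching_swap:
  fixes w :: "'a \<Rightarrow> real"
  assumes "finite S" "A \<subseteq> S" "f ` A \<subseteq> S" "inj_on f A" "A \<inter> f ` A = {}"
  shows "\<exists>\<tau>. \<tau> permutes S \<and> (\<forall>g. (\<Sum>i\<in>S. w i * g (\<tau> i)) =
           (\<Sum>i\<in>S. w i * g i) + (\<Sum>i\<in>A. (w i - w (f i)) * (g (f i) - g i)))"
proof -
  have "finite A" using assms finite_subset by blast
  then show ?thesis using assms(2-)
  proof (induction A rule: finite_induct)
    case empty
    show ?case by (intro exI[of _ id] conjI permutes_id) simp
  next
    case (insert x A)
    then obtain \<tau> where \<tau>: "\<tau> permutes S"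
      "\<And>g. (\<Sum>i\<in>S. w i * g (\<tau> i)) =
           (\<Sum>i\<in>S. w i * g i) + (\<Sum>i\<in>A. (w i - w (f i)) * (g (f i) - g i))"
      by auto
    let ?t = "Transposition.transpose x (f x)"
    have xS: "x \<in> S" "f x \<in> S" "x \<noteq> f x" using insert.prems by auto
    have "(\<Sum>i\<in>S. w i * g ((?t \<circ> \<tau>) i)) = (\<Sum>i\<in>S. w i * g i) +
        (\<Sum>i\<in>insert x A. (w i - w (f i)) * (g (f i) - g i))" for g :: "'a \<Rightarrow> real"
    proof -
      have fix_i: "?t i = i" "?t (f i) = f i" if "i \<in> A" for i
        using that insert.prems insert.hyps by (auto simp: Transposition.transpose_def inj_on_def)
      \<comment> \<open>The induction hypothesis is used for \<open>g\<close> composed with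
        \<open>?t\<close>; as \<open>?t\<close> fixes both ends of every pair from \<open>A\<close>,
        their contribution is unchanged.\<close>
      have "(\<Sum>i\<in>S. w i * g ((?t \<circ> \<tau>) i)) =
          (\<Sum>i\<in>S. w i * g (?t i)) + (\<Sum>i\<in>A. (w i - w (f i)) * (g (?t (f i)) - g (?t i)))"
        using \<tau>(2)[of "\<lambda>i. g (?t i)"] by simp
      also have "(\<Sum>i\<in>A. (w i - w (f i)) * (g (?t (f i)) - g (?t i))) =
          (\<Sum>i\<in>A. (w i - w (f i)) * (g (f i) - g i))"
        by (intro sum.cong) (auto simp: fix_i)
      finally show ?thesis
        using sum_transpose[OF assms(1) xS, of w g] insert.hyps by simp
    qed
    moreover have "?t \<circ> \<tau> permutes S"
      using \<tau>(1) xS by (intro permutes_compose permutes_swap_id) auto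
    ultimately show ?case by blast
  qed
qed

text \<open>Double counting of pairs of a permutation \<open>p\<close> and a set \<open>T\<close> of
  pairs to swap. Swapping along \<open>T\<close> maps the permutations bijectively onto themselves,
  so every \<open>T\<close> gives the same count; for fixed \<open>p\<close> the Littlewood-Offord
  inequality with coefficients \<open>d p\<close> bounds the number of \<open>T\<close>. The factor
  \<open>2 ^ card A\<close> cancels.\<close>

lemma card_perm_sum_le:
  fixes w v :: "'a \<Rightarrow> real"
  assumes fin: "finite S" and A: "A \<subseteq> S" "f ` A \<subseteq> S" "inj_on f A" "A \<inter> f ` A = {}"
    and w: "\<And>i. i \<in> A \<Longrightarrow> w i \<noteq> w (f i)"
  shows "real (card {p. p permutes S \<and> (\<Sum>i\<in>S. w i * v (p i)) = x})
    \<le> (\<Sum>p | p permutes S. 1 / sqrt (real (card {i \<in> A. v (p i) \<noteq> v (p (f i))}) + 1))"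
proof -
  define P where "P = {p. p permutes S}"
  define X where "X = (\<lambda>p. \<Sum>i\<in>S. w i * v (p i))"
  define d where "d = (\<lambda>p i. (w i - w (f i)) * (v (p (f i)) - v (p i)))"
  define N where "N = (\<lambda>p. card {i \<in> A. v (p i) \<noteq> v (p (f i))})"
  have finA: "finite A" using A(1) fin finite_subset by blast
  then have finPow: "finite (Pow A)" by simp
  have finP: "finite P" unfolding P_def using fin by (rule finite_permutations)
  have swap: "card {p \<in> P. X p = x} = card {p \<in> P. X p + sum (d p) T = x}" if T: "T \<in> Pow A" for T
  proof -
    have "inj_on f T" using T A(3) by (auto intro: inj_on_subset)
    moreover have "T \<inter> f ` T = {}" "T \<subseteq> S" "f ` T \<subseteq> S" using T A by blast+
    ultimately obtain \<tau> where \<tau>: "\<tau> permutes S"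
      "\<And>g. (\<Sum>i\<in>S. w i * g (\<tau> i)) =
           (\<Sum>i\<in>S. w i * g i) + (\<Sum>i\<in>T. (w i - w (f i)) * (g (f i) - g i))"
      using exists_matching_swap[OF fin, of T f w] by blast
    have X\<tau>: "X (p \<circ> \<tau>) = X p + sum (d p) T" for p
      using \<tau>(2)[of "\<lambda>i. v (p i)"] by (simp add: X_def d_def)
    have im: "(\<lambda>p. p \<circ> \<tau>) ` {p \<in> P. X (p \<circ> \<tau>) = x} = {p \<in> P. X p = x}"
    proof (intro equalityI subsetI)
      fix q assume q: "q \<in> {p \<in> P. X p = x}"
      have "q = (q \<circ> inv \<tau>) \<circ> \<tau>"
        using \<tau>(1) by (simp add: o_assoc[symmetric] permutes_inv_o)
      moreover have "q \<circ> inv \<tau> \<in> P"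
        using q \<tau>(1) by (auto simp: P_def intro: permutes_compose permutes_inv)
      ultimately show "q \<in> (\<lambda>p. p \<circ> \<tau>) ` {p \<in> P. X (p \<circ> \<tau>) = x}"
        using q by (intro image_eqI[of _ _ "q \<circ> inv \<tau>"]) auto
    qed (use \<tau>(1) in \<open>auto simp: P_def intro: permutes_compose\<close>)
    have inj: "inj_on (\<lambda>p. p \<circ> \<tau>) {p \<in> P. X (p \<circ> \<tau>) = x}"
    proof (rule inj_onI)
      fix p q assume "p \<circ> \<tau> = q \<circ> \<tau>"
      then have "p \<circ> \<tau> \<circ> inv \<tau> = q \<circ> \<tau> \<circ> inv \<tau>" by simp
      then show "p = q" using \<tau>(1) by (simp add: o_assoc[symmetric] permutes_inv_o)
    qed
    show ?thesis using card_image[OF inj] by (simp add: im X\<tau>[symmetric])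
  qed
  have "2 ^ card A * real (card {p \<in> P. X p = x}) = (\<Sum>T\<in>Pow A. real (card {p \<in> P. X p = x}))"
    using finA by (simp add: card_Pow)
  also have "\<dots> = (\<Sum>T\<in>Pow A. real (card {p \<in> P. X p + sum (d p) T = x}))"
    by (intro sum.cong refl) (simp only: swap)
  also have "\<dots> = (\<Sum>T\<in>Pow A. \<Sum>p\<in>{p \<in> P. X p + sum (d p) T = x}. 1)"
    by simp
  also have "\<dots> = (\<Sum>p\<in>P. \<Sum>T\<in>{T \<in> Pow A. X p + sum (d p) T = x}. 1)"
    by (rule sum.swap_restrict[OF finPow finP, where R = "\<lambda>T p. X p + sum (d p) T = x"])
  also have "\<dots> = (\<Sum>p\<in>P. real (card {T \<in> Pow A. sum (d p) T = x - X p}))"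
    by (simp add: algebra_simps)
  also have "\<dots> \<le> (\<Sum>p\<in>P. 2 ^ card A / sqrt (real (N p) + 1))"
  proof (rule sum_mono)
    fix p
    \<comment> \<open>Since \<open>w\<close> differs at the two ends of each pair,
      \<open>d p i\<close> vanishes exactly when \<open>v\<close> agrees at their images, so
      \<open>N p\<close> counts the nonzero coefficients.\<close>
    have "{i \<in> A. d p i \<noteq> 0} = {i \<in> A. v (p i) \<noteq> v (p (f i))}"
      using w by (auto simp: d_def)
    then show "real (card {T \<in> Pow A. sum (d p) T = x - X p}) \<le> 2 ^ card A / sqrt (real (N p) + 1)"
      using Littlewood_Offord[OF finA, of "d p" "x - X p"] by (simp add: N_def)
  qed
  also have "\<dots> = 2 ^ card A * (\<Sum>p\<in>P. 1 / sqrt (real (N p) + 1))"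
    by (simp add: sum_distrib_left)
  finally show ?thesis
    by (simp add: P_def X_def N_def)
qed

section \<open>Moments of the number of split pairs\<close>

lemma exists_permutes_map_eq:
  assumes "finite S" "distinct xs" "distinct ys" "set xs \<subseteq> S" "set ys \<subseteq> S" "length xs = length ys"
  shows "\<exists>\<sigma>. \<sigma> permutes S \<and> map \<sigma> xs = ys"
  using assms(6,2-5)
proof (induction xs ys rule: list_induct2)
  case Nil
  show ?case by (intro exI[of _ id] conjI permutes_id) simp
next
  case (Cons x xs y ys)
  then obtain \<sigma> where \<sigma>: "\<sigma> permutes S" "map \<sigma> xs = ys" by auto
  \<comment> \<open>\<open>?t\<close> moves \<open>\<sigma> x\<close> to \<open>y\<close> and fixes
    every entry of \<open>ys\<close>: these are images of \<open>xs\<close>, hence differ from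
    \<open>\<sigma> x\<close> by injectivity, and \<open>y\<close> is not among them.\<close>
  let ?t = "Transposition.transpose (\<sigma> x) y"
  have "\<sigma> x \<in> S" using \<sigma>(1) Cons.prems by (simp add: permutes_in_image)
  then have "?t \<circ> \<sigma> permutes S"
    using \<sigma>(1) Cons.prems by (intro permutes_compose permutes_swap_id) auto
  moreover have "map (?t \<circ> \<sigma>) (x # xs) = y # ys"
  proof -
    have "\<sigma> z \<noteq> \<sigma> x" "\<sigma> z \<noteq> y" if "z \<in> set xs" for z
      using that Cons.prems \<sigma> permutes_inj[OF \<sigma>(1)] by (auto dest: injD)
    then have "map (?t \<circ> \<sigma>) xs = map \<sigma> xs" by (auto simp: Transposition.transpose_def)
    then show ?thesis
      by (simp only: list.map o_apply transpose_apply_first \<sigma>(2))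
  qed
  ultimately show ?case by (intro exI[of _ "?t \<circ> \<sigma>"] conjI)
qed

text \<open>The image of a fixed tuple of distinct elements under a uniformly random permutation is
  uniform on \<open>L\<close>; the equation expresses this with denominators cleared. It is applied
  to tuples of length 2 and 4.\<close>

lemma sum_permutes_map:
  fixes F :: "'a list \<Rightarrow> real"
  assumes fin: "finite S" and t: "distinct t" "set t \<subseteq> S"
  defines "L \<equiv> {u. length u = length t \<and> distinct u \<and> set u \<subseteq> S}"
  shows "real (card L) * (\<Sum>p | p permutes S. F (map p t)) = fact (card S) * (\<Sum>u\<in>L. F u)"
proof -
  \<comment> \<open>The sum over \<open>p\<close> does not depend on \<open>t \<in> L\<close>, so it may be averaged over \<open>L\<close>, which each \<open>p\<close> permutes.\<close>
  define P where "P = {p. p permutes S}"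
  have const: "(\<Sum>p\<in>P. F (map p u)) = (\<Sum>p\<in>P. F (map p t))" if u: "u \<in> L" for u
  proof -
    obtain \<sigma> where \<sigma>: "\<sigma> permutes S" "map \<sigma> t = u"
      using exists_permutes_map_eq[OF fin t(1), of u] t u by (auto simp: L_def)
    have "(\<Sum>p\<in>P. F (map p t)) = (\<Sum>p\<in>P. F (map (p \<circ> \<sigma>) t))"
      unfolding P_def by (rule sum_permutations_compose_right[OF \<sigma>(1)])
    also have "\<dots> = (\<Sum>p\<in>P. F (map p u))"
      by (simp add: \<sigma>(2)[symmetric])
    finally show ?thesis by simp
  qed
  have perm_L: "(\<Sum>u\<in>L. F (map p u)) = (\<Sum>u\<in>L. F u)" if p: "p \<in> P" for p
  proof (rule sum.reindex_bij_betw)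
    have p: "p permutes S" using p by (simp add: P_def)
    show "bij_betw (map p) L L"
      by (rule bij_betw_byWitness[where f' = "map (inv p)"])
        (use p permutes_inv[OF p] in \<open>auto simp: L_def distinct_map permutes_inverses
            permutes_in_image subset_iff intro: permutes_inj_on intro!: map_idI\<close>)
  qed
  have "real (card L) * (\<Sum>p\<in>P. F (map p t)) = (\<Sum>u\<in>L. \<Sum>p\<in>P. F (map p u))"
    by (simp add: const)
  also have "\<dots> = (\<Sum>p\<in>P. \<Sum>u\<in>L. F (map p u))" by (rule sum.swap)
  also have "\<dots> = fact (card S) * (\<Sum>u\<in>L. F u)"
    using fin by (simp add: perm_L P_def card_permutations)
  finally show ?thesis by (simp add: P_def)
qed


lemma sum_permutes_split_pair:
  fixes v :: "'a \<Rightarrow> 'b"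
  assumes fin: "finite S" and n: "card S = n" "n \<ge> 2" and ij: "i \<in> S" "j \<in> S" "i \<noteq> j"
  defines "E \<equiv> {(a, b). a \<in> S \<and> b \<in> S \<and> v a \<noteq> v b}"
  shows "real n * (real n - 1) * (\<Sum>p | p permutes S. of_bool (v (p i) \<noteq> v (p j)))
    = fact n * real (card E)"
proof -
  define L where "L = {u. length u = 2 \<and> distinct u \<and> set u \<subseteq> S}"
  define F where "F = (\<lambda>u. of_bool (v (u ! 0) \<noteq> v (u ! 1)) :: real)"
  have "card L = \<Prod>{n - 2 + 1..n}"
    unfolding L_def using card_lists_distinct_length_eq[OF fin, of 2] n by simp
  moreover have "{n - 2 + 1..n} = {n - 1, n}" using n by auto
  ultimately have cL: "real (card L) = real n * (real n - 1)"
    using n by simp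
  have finL: "finite L"
    unfolding L_def by (rule finite_subset[OF _ finite_lists_length_eq[OF fin, of 2]]) auto
  \<comment> \<open>Elements with different values of \<open>v\<close> are distinct, so the lists
    counted here correspond exactly to \<open>E\<close> and the result is an equality.\<close>
  have "{u \<in> L. v (u ! 0) \<noteq> v (u ! 1)} = (\<lambda>(a, b). [a, b]) ` E"
    by (auto simp: L_def E_def length_Suc_conv numeral_2_eq_2 image_iff)
  moreover have "inj_on (\<lambda>(a, b). [a, b]) E" by (auto simp: inj_on_def)
  ultimately have "card {u \<in> L. v (u ! 0) \<noteq> v (u ! 1)} = card E"
    by (simp add: card_image)
  then have "(\<Sum>u\<in>L. F u) = real (card E)"
    using finL by (simp add: F_def Int_def)
  then show ?thesis
    using sum_permutes_map[OF fin, of "[i, j]" F] ij cL n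
    by (simp add: F_def L_def numeral_2_eq_2)
qed

text \<open>Only an inequality is obtained, because embedding the lists of four distinct elements
  into \<open>E \<times> E\<close> forgets that the two pairs are disjoint.\<close>

lemma sum_permutes_split_two_pairs:
  fixes v :: "'a \<Rightarrow> 'b"
  assumes fin: "finite S" and n: "card S = n" "n \<ge> 4"
    and t: "distinct [i, j, k, l]" "{i, j, k, l} \<subseteq> S"
  defines "E \<equiv> {(a, b). a \<in> S \<and> b \<in> S \<and> v a \<noteq> v b}"
  shows "real n * (real n - 1) * ((real n - 2) * (real n - 3)) *
      (\<Sum>p | p permutes S. of_bool (v (p i) \<noteq> v (p j)) * of_bool (v (p k) \<noteq> v (p l)))
    \<le> fact n * (real (card E))\<^sup>2"
proof -
  define L where "L = {u. length u = 4 \<and> distinct u \<and> set u \<subseteq> S}"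
  define G where "G = (\<lambda>u. v (u ! 0) \<noteq> v (u ! 1) \<and> v (u ! 2) \<noteq> v (u ! 3))"
  define F where "F = (\<lambda>u. of_bool (G u) :: real)"
  have "card L = \<Prod>{n - 4 + 1..n}"
    unfolding L_def using card_lists_distinct_length_eq[OF fin, of 4] n by simp
  moreover have "{n - 4 + 1..n} = {n - 3, n - 2, n - 1, n}" using n by auto
  moreover have "n - 3 \<noteq> n - 2" "n - 3 \<noteq> n - 1" "n - 3 \<noteq> n" "n - 2 \<noteq> n - 1" "n - 2 \<noteq> n" "n - 1 \<noteq> n"
    using n by auto
  ultimately have "card L = (n - 3) * ((n - 2) * ((n - 1) * n))" by simp
  then have cL: "real (card L) = real n * (real n - 1) * ((real n - 2) * (real n - 3))"
    using n by simp
  have finE: "finite E"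
    unfolding E_def by (rule finite_subset[of _ "S \<times> S"]) (use fin in auto)
  have finL: "finite L"
    unfolding L_def by (rule finite_subset[OF _ finite_lists_length_eq[OF fin, of 4]]) auto
  have "{u \<in> L. G u} \<subseteq> (\<lambda>((a, b), (c, d)). [a, b, c, d]) ` (E \<times> E)"
  proof
    fix u assume u: "u \<in> {u \<in> L. G u}"
    then have "length u = Suc (Suc (Suc (Suc 0)))" by (simp add: L_def)
    then obtain a b c d where abcd: "u = [a, b, c, d]"
      by (auto simp: length_Suc_conv)
    then have "((a, b), (c, d)) \<in> E \<times> E" using u by (auto simp: L_def G_def E_def)
    then show "u \<in> (\<lambda>((a, b), (c, d)). [a, b, c, d]) ` (E \<times> E)"
      using abcd by (intro image_eqI[of _ _ "((a, b), (c, d))"]) auto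
  qed
  then have "card {u \<in> L. G u} \<le> card (E \<times> E)"
    using finE by (intro surj_card_le) auto
  then have "real (card {u \<in> L. G u}) \<le> (real (card E))\<^sup>2"
    by (simp add: card_cartesian_product power2_eq_square flip: of_nat_mult)
  moreover have "(\<Sum>u\<in>L. F u) = real (card {u \<in> L. G u})"
    using finL by (simp add: F_def Int_def)
  ultimately have "fact n * (\<Sum>u\<in>L. F u) \<le> fact n * (real (card E))\<^sup>2"
    by simp
  moreover have "real (card L) * (\<Sum>p | p permutes S. F (map p [i, j, k, l])) = fact n * (\<Sum>u\<in>L. F u)"
    using sum_permutes_map[OF fin t(1), of F] t(2) n by (simp add: L_def eval_nat_numeral)
  moreover have "F (map p [i, j, k, l]) = of_bool (v (p i) \<noteq> v (p j)) * of_bool (v (p k) \<noteq> v (p l))" for p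
    by (simp add: F_def G_def)
  ultimately show ?thesis by (simp add: cL)
qed

text \<open>Here \<open>\<mu>\<close> is the exact mean of \<open>N\<close>. In the mean of the
  square, the diagonal terms add up to \<open>\<mu>\<close> and the others to at most \<mu>^2 times
  n (n - 1) / ((n - 2) (n - 3)), the price of sampling without replacement.\<close>

lemma split_pairs_variance:
  fixes v :: "'a \<Rightarrow> 'b" and f :: "'a \<Rightarrow> 'a"
  assumes fin: "finite S" and n: "card S = n" "n \<ge> 4"
    and A: "A \<subseteq> S" "f ` A \<subseteq> S" "inj_on f A" "A \<inter> f ` A = {}"
  defines "N \<equiv> (\<lambda>p. real (card {i \<in> A. v (p i) \<noteq> v (p (f i))}))"
    and "\<mu> \<equiv> real (card A) * real (card {(a, b). a \<in> S \<and> b \<in> S \<and> v a \<noteq> v b}) / (real n * (real n - 1))"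
  shows "(\<Sum>p | p permutes S. (N p - \<mu>)\<^sup>2)
    \<le> fact n * (\<mu> + \<mu>\<^sup>2 * (real n * (real n - 1) / ((real n - 2) * (real n - 3)) - 1))"
proof -
  define P where "P = {p. p permutes S}"
  define D where "D = real (card {(a, b). a \<in> S \<and> b \<in> S \<and> v a \<noteq> v b})"
  define m where "m = real n * (real n - 1)"
  define m' where "m' = (real n - 2) * (real n - 3)"
  define M where "M = real (card A)"
  define b where "b = (\<lambda>p i. of_bool (v (p i) \<noteq> v (p (f i))) :: real)"
  have m: "m > 0" "m' > 0" using n by (auto simp: m_def m'_def)
  have finA: "finite A" using A(1) fin finite_subset by blast
  have cP: "real (card P) = fact n" using fin n by (simp add: P_def card_permutations)
  have mu: "\<mu> = M * D / m" by (simp add: \<mu>_def M_def D_def m_def)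
  have Nb: "N p = (\<Sum>i\<in>A. b p i)" for p
    using finA by (simp add: N_def b_def Int_def)
  have single: "(\<Sum>p\<in>P. b p i) = fact n * (D / m)" if i: "i \<in> A" for i
  proof -
    have "i \<noteq> f i" using i A(4) by auto
    then have "m * (\<Sum>p\<in>P. b p i) = fact n * D"
      using sum_permutes_split_pair[OF fin n(1), of i "f i" v] i A n
      unfolding P_def b_def m_def D_def by auto
    then show ?thesis using m by (simp add: field_simps)
  qed
  have double: "(\<Sum>p\<in>P. b p i * b p j) \<le> fact n * (D\<^sup>2 / (m * m'))" if ij: "i \<in> A" "j \<in> A" "i \<noteq> j" for i j
  proof -
    have "distinct [i, f i, j, f j]"
      using ij A(3,4) by (auto simp: inj_on_def)
    then have "m * m' * (\<Sum>p\<in>P. b p i * b p j) \<le> fact n * D\<^sup>2"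
      using sum_permutes_split_two_pairs[OF fin n, of i "f i" j "f j" v] ij A
      unfolding P_def b_def m_def m'_def D_def by auto
    then show ?thesis using m by (simp add: field_simps)
  qed
  have EN: "(\<Sum>p\<in>P. N p) = fact n * \<mu>"
  proof -
    have "(\<Sum>p\<in>P. N p) = (\<Sum>i\<in>A. \<Sum>p\<in>P. b p i)"
      unfolding Nb by (rule sum.swap)
    also have "\<dots> = fact n * \<mu>" by (simp add: single mu M_def)
    finally show ?thesis .
  qed
  have ENN: "(\<Sum>p\<in>P. (N p)\<^sup>2) \<le> fact n * (\<mu> + M\<^sup>2 * (D\<^sup>2 / (m * m')))"
  proof -
    have "(\<Sum>p\<in>P. (N p)\<^sup>2) = (\<Sum>p\<in>P. \<Sum>i\<in>A. \<Sum>j\<in>A. b p i * b p j)"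
      by (simp add: Nb power2_eq_square sum_product)
    also have "\<dots> = (\<Sum>i\<in>A. \<Sum>p\<in>P. \<Sum>j\<in>A. b p i * b p j)"
      by (rule sum.swap)
    also have "\<dots> = (\<Sum>i\<in>A. \<Sum>j\<in>A. \<Sum>p\<in>P. b p i * b p j)"
      by (intro sum.cong refl sum.swap)
    \<comment> \<open>The off-diagonal bound is granted to the diagonal as well, so the double sum
      becomes \<open>M\<^sup>2\<close> equal terms plus a diagonal correction.\<close>
    also have "\<dots> \<le> (\<Sum>i\<in>A. \<Sum>j\<in>A. fact n * (D\<^sup>2 / (m * m')) + (if j = i then fact n * (D / m) else 0))"
    proof (intro sum_mono)
      fix i j assume ij: "i \<in> A" "j \<in> A"
      have "b p i * b p i = b p i" for p by (simp add: b_def)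
      then have "(\<Sum>p\<in>P. b p i * b p i) = fact n * (D / m)"
        using single ij by (simp only:)
      moreover have "0 \<le> fact n * (D\<^sup>2 / (m * m'))" using m by simp
      ultimately show "(\<Sum>p\<in>P. b p i * b p j)
          \<le> fact n * (D\<^sup>2 / (m * m')) + (if j = i then fact n * (D / m) else 0)"
        using double[of i j] ij by auto
    qed
    also have "\<dots> = fact n * (\<mu> + M\<^sup>2 * (D\<^sup>2 / (m * m')))"
      using finA by (simp add: sum.distrib mu M_def power2_eq_square algebra_simps)
    finally show ?thesis .
  qed
  have "(\<Sum>p\<in>P. (N p - \<mu>)\<^sup>2) = (\<Sum>p\<in>P. (N p)\<^sup>2) - (\<Sum>p\<in>P. N p) * (2 * \<mu>) + fact n * \<mu>\<^sup>2"
    by (simp add: power2_diff sum.distrib sum_subtractf flip: sum_distrib_left sum_distrib_right)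
      (simp add: cP mult_ac flip: sum_distrib_left sum_distrib_right)
  also have "\<dots> \<le> fact n * (\<mu> + M\<^sup>2 * (D\<^sup>2 / (m * m')) - \<mu>\<^sup>2)"
    using ENN by (simp add: EN power2_eq_square algebra_simps)
  also have "M\<^sup>2 * (D\<^sup>2 / (m * m')) = \<mu>\<^sup>2 * (m / m')"
    using m by (simp add: mu power2_eq_square field_simps)
  finally show ?thesis by (simp add: P_def m_def m'_def algebra_simps)
qed

section \<open>From the second moment to point probabilities\<close>

text \<open>Pointwise form of Chebyshev's argument, ready to be summed over permutations: if y \<ge>
  \<mu> / 2 the first summand suffices, otherwise the deviation exceeds \<mu> / 2 and the second
  summand is already at least 1.\<close>

lemma inverse_sqrt_le_deviation:
  fixes y \<mu> :: real
  assumes "y \<ge> 0" "\<mu> > 0"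
  shows "1 / sqrt (y + 1) \<le> sqrt 2 / sqrt \<mu> + 4 * (y - \<mu>)\<^sup>2 / \<mu>\<^sup>2"
proof (cases "y \<ge> \<mu> / 2")
  case True
  have "1 / sqrt (y + 1) \<le> 1 / sqrt (\<mu> / 2)"
    using True assms by (intro divide_left_mono) auto
  also have "\<dots> = sqrt 2 / sqrt \<mu>" by (simp add: real_sqrt_divide)
  finally show ?thesis by (simp add: add_increasing2)
next
  case False
  have "(\<mu> / 2)\<^sup>2 \<le> (\<mu> - y)\<^sup>2"
    using False assms by (intro power_mono) auto
  then have "1 \<le> 4 * (y - \<mu>)\<^sup>2 / \<mu>\<^sup>2"
    using assms by (simp add: field_simps power2_commute[of y])
  moreover have "1 / sqrt (y + 1) \<le> 1" using assms by simp
  moreover have "sqrt 2 / sqrt \<mu> \<ge> 0" using assms by simp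
  ultimately show ?thesis by linarith
qed

text \<open>The left side equals (4n - 6) / ((n - 2) (n - 3)), where n - 2 \<ge> n / 2 and n - 3
  \<ge> n / 4. The order 1 / n is what makes the variance linear in its mean.\<close>

lemma falling_ratio_bound:
  fixes n :: real
  assumes "n \<ge> 4"
  shows "n * (n - 1) / ((n - 2) * (n - 3)) - 1 \<le> 32 / n"
proof -
  have "(n / 2) * (n / 4) \<le> (n - 2) * (n - 3)"
    using assms by (intro mult_mono) auto
  then have "4 * n / ((n - 2) * (n - 3)) \<le> 4 * n / ((n / 2) * (n / 4))"
    using assms by (intro divide_left_mono) auto
  also have "\<dots> = 32 / n" using assms by (simp add: field_simps)
  finally have "4 * n / ((n - 2) * (n - 3)) \<le> 32 / n" .
  moreover have "n * (n - 1) / ((n - 2) * (n - 3)) - 1 = (4 * n - 6) / ((n - 2) * (n - 3))"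
  proof -
    have "n * (n - 1) = (n - 2) * (n - 3) + (4 * n - 6)" by (simp add: algebra_simps)
    moreover have "(n - 2) * (n - 3) \<noteq> 0" using assms by simp
    ultimately show ?thesis by (simp only: add_divide_distrib) simp
  qed
  moreover have "(4 * n - 6) / ((n - 2) * (n - 3)) \<le> 4 * n / ((n - 2) * (n - 3))"
    using assms by (intro divide_right_mono) auto
  ultimately show ?thesis by linarith
qed

text \<open>Pairs are counted by their first entry \<open>a\<close>: at most \<open>k\<close> second
  entries share the value \<open>v a\<close>.\<close>

lemma card_unequal_pairs_ge:
  fixes v :: "'a \<Rightarrow> 'b"
  assumes fin: "finite S" and mult: "\<And>z. real (card {i \<in> S. v i = z}) \<le> k"
  shows "real (card {(a, b). a \<in> S \<and> b \<in> S \<and> v a \<noteq> v b}) \<ge> real (card S) * (real (card S) - k)"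
proof -
  have "{(a, b). a \<in> S \<and> b \<in> S \<and> v a \<noteq> v b} = Sigma S (\<lambda>a. S - {i \<in> S. v i = v a})"
    by auto
  then have "real (card {(a, b). a \<in> S \<and> b \<in> S \<and> v a \<noteq> v b})
      = (\<Sum>a\<in>S. real (card (S - {i \<in> S. v i = v a})))"
    using fin by simp
  also have "\<dots> = (\<Sum>a\<in>S. real (card S) - real (card {i \<in> S. v i = v a}))"
    using fin by (intro sum.cong refl) (simp add: card_Diff_subset card_mono)
  also have "\<dots> \<ge> (\<Sum>a\<in>S. real (card S) - k)"
    by (intro sum_mono) (use mult in auto)
  finally show ?thesis by simp
qed

lemma card_perm_sum_bound:
  fixes w v :: "'a \<Rightarrow> real" and c :: real
  assumes c: "0 < c" "c < 1" and fin: "finite S" and ne: "S \<noteq> {}"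
    and w: "\<And>z. real (card {i \<in> S. w i = z}) \<le> c * card S"
    and v: "\<And>z. real (card {i \<in> S. v i = z}) \<le> c * card S"
  shows "real (card {p. p permutes S \<and> (\<Sum>i\<in>S. w i * v (p i)) = x})
    \<le> fact (card S) * (134 / sqrt ((1 - c)\<^sup>2 / 2) / sqrt (card S))"
proof -
  define n where "n = card S"
  define P where "P = {p. p permutes S}"
  \<comment> \<open>\<open>\<delta>\<close> is the constant in
    \<open>\<delta> * n \<le> \<mu>\<close>: a factor (1 - c) / 2 comes from the size of the
    matching, a factor 1 - c from the proportion of unequal pairs.\<close>
  define \<delta> where "\<delta> = (1 - c)\<^sup>2 / 2"
  define Q where "Q = {p. p permutes S \<and> (\<Sum>i\<in>S. w i * v (p i)) = x}"
  have n0: "n > 0" using fin ne by (simp add: n_def card_gt_0_iff)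
  have finP: "finite P" unfolding P_def using fin by (rule finite_permutations)
  have cP: "card P = fact n" using fin by (simp add: P_def n_def card_permutations)
  have \<delta>: "\<delta> > 0" "\<delta> < 1"
    using c by (auto simp: \<delta>_def power2_eq_square intro: order.strict_trans1[OF mult_left_le])
  have "card Q \<le> fact n"
    unfolding cP[symmetric] using finP by (intro card_mono) (auto simp: Q_def P_def)
  then have triv: "real (card Q) \<le> fact n" by (metis of_nat_fact of_nat_le_iff)
  obtain A f z where A: "A \<subseteq> S" "f ` A \<subseteq> S" "inj_on f A" "A \<inter> f ` A = {}"
    "\<And>i. i \<in> A \<Longrightarrow> w i \<noteq> w (f i)" "card S \<le> 2 * card A + card {i \<in> S. w i = z}"
    using exists_unequal_matching[OF fin, of w] by blast
  define M where "M = real (card A)"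
  define D where "D = real (card {(a, b). a \<in> S \<and> b \<in> S \<and> v a \<noteq> v b})"
  define \<mu> where "\<mu> = M * D / (real n * (real n - 1))"
  define N where "N = (\<lambda>p. real (card {i \<in> A. v (p i) \<noteq> v (p (f i))}))"
  have M_lower: "M \<ge> (1 - c) * n / 2"
  proof -
    have "real n \<le> 2 * M + c * n"
      using of_nat_mono[OF A(6), where 'a = real] w[of z] by (simp add: n_def M_def)
    then show ?thesis by (simp add: algebra_simps)
  qed
  have M_upper: "M \<le> n"
    using A(1) fin by (simp add: M_def n_def card_mono)
  have D_lower: "D \<ge> n * ((1 - c) * n)"
    using card_unequal_pairs_ge[OF fin v] by (simp add: D_def n_def algebra_simps)
  have D_upper: "D \<le> real n * (real n - 1)"
  proof -
    have "D \<le> real (card (Sigma S (\<lambda>a. S - {a})))"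
      unfolding D_def of_nat_le_iff using fin by (intro card_mono) auto
    also have "\<dots> = real n * (real n - 1)"
      using fin n0 by (simp add: n_def)
    finally show ?thesis .
  qed
  have mu_lower: "\<delta> * n \<le> \<mu>" if "n \<ge> 4"
  proof -
    have "\<delta> * n * (real n * (real n - 1)) \<le> \<delta> * n * (real n * real n)"
      using \<delta> by (intro mult_left_mono) auto
    also have "\<dots> = ((1 - c) * n / 2) * (n * ((1 - c) * n))"
      by (simp add: \<delta>_def power2_eq_square)
    also have "\<dots> \<le> M * D"
      using M_lower D_lower c by (intro mult_mono) (auto simp: M_def)
    finally show ?thesis using that by (simp add: \<mu>_def field_simps)
  qed
  show ?thesis
  proof (cases "n \<ge> 4 \<and> \<mu> \<ge> 1")
    case False
    \<comment> \<open>In the degenerate cases \<open>\<delta> * n\<close> is at most 4, so the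
      claimed bound is at least \<open>fact n\<close> and the trivial count suffices; 134 squared is
      only the form matching the target constant.\<close>
    have "\<delta> * n \<le> 134\<^sup>2"
    proof (cases "n \<ge> 4")
      case True
      then show ?thesis using False mu_lower by simp
    next
      case False
      then have "real n \<le> 4" by simp
      then have "\<delta> * n \<le> 1 * 4" using \<delta> by (intro mult_mono) auto
      then show ?thesis by simp
    qed
    then have "sqrt (\<delta> * n) \<le> 134" by (intro real_le_lsqrt) auto
    then have "134 / sqrt \<delta> / sqrt n \<ge> 1"
      using \<delta> n0 by (simp add: field_simps real_sqrt_mult)
    then have "fact n * 1 \<le> fact n * (134 / sqrt \<delta> / sqrt n)"
      by (intro mult_left_mono) auto
    then show ?thesis using triv by (simp add: Q_def n_def \<delta>_def)
  next
    case True
    then have n4: "n \<ge> 4" and mu1: "\<mu> \<ge> 1" by auto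
    have mu_n: "\<mu> \<le> n"
    proof -
      have "M * D \<le> n * (real n * (real n - 1))"
        using M_upper D_upper by (intro mult_mono) (auto simp: D_def)
      then show ?thesis using n4 by (simp add: \<mu>_def field_simps)
    qed
    have "(\<Sum>p\<in>P. (N p - \<mu>)\<^sup>2) \<le> fact n * (\<mu> + \<mu>\<^sup>2 * (real n * (real n - 1) / ((real n - 2) * (real n - 3)) - 1))"
      unfolding P_def N_def \<mu>_def M_def D_def
      by (rule split_pairs_variance[OF fin n_def[symmetric] n4 A(1-4)])
    \<comment> \<open>One factor of \<open>\<mu>\<^sup>2\<close> is bounded by \<open>n\<close>,
      which cancels against 32 / n; then 33 = 1 + 32.\<close>
    also have "\<dots> \<le> fact n * (33 * \<mu>)"
    proof (rule mult_left_mono)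
      have "\<mu>\<^sup>2 * (real n * (real n - 1) / ((real n - 2) * (real n - 3)) - 1) \<le> (\<mu> * n) * (32 / n)"
        using n4 falling_ratio_bound[of n] mu1 mu_n
        by (intro order.trans[OF mult_left_mono mult_right_mono]) (auto simp: power2_eq_square)
      then show "\<mu> + \<mu>\<^sup>2 * (real n * (real n - 1) / ((real n - 2) * (real n - 3)) - 1) \<le> 33 * \<mu>"
        using n4 by simp
    qed simp
    finally have var: "(\<Sum>p\<in>P. (N p - \<mu>)\<^sup>2) \<le> fact n * (33 * \<mu>)" .
    have "real (card Q) \<le> (\<Sum>p\<in>P. 1 / sqrt (N p + 1))"
      unfolding Q_def P_def N_def using A(5) by (rule card_perm_sum_le[OF fin A(1-4)])
    also have "\<dots> \<le> (\<Sum>p\<in>P. sqrt 2 / sqrt \<mu> + 4 * (N p - \<mu>)\<^sup>2 / \<mu>\<^sup>2)"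
      using mu1 by (intro sum_mono inverse_sqrt_le_deviation) (auto simp: N_def)
    also have "\<dots> = fact n * (sqrt 2 / sqrt \<mu>) + 4 / \<mu>\<^sup>2 * (\<Sum>p\<in>P. (N p - \<mu>)\<^sup>2)"
      by (simp add: sum.distrib sum_distrib_left cP)
    also have "\<dots> \<le> fact n * (sqrt 2 / sqrt \<mu>) + 4 / \<mu>\<^sup>2 * (fact n * (33 * \<mu>))"
      using var by (intro add_left_mono mult_left_mono) auto
    also have "\<dots> = fact n * (sqrt 2 / sqrt \<mu> + 132 / \<mu>)"
      using mu1 by (simp add: power2_eq_square field_simps)
    \<comment> \<open>As \<mu> \<ge> 1, the term of order 1 / \<mu> is absorbed into 1 / sqrt \<mu>.
      Here 132 = 4 * 33, and 134 = 132 + 2 with sqrt 2 \<le> 2.\<close>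
    also have "\<dots> \<le> fact n * (134 / sqrt \<mu>)"
    proof (rule mult_left_mono)
      have "sqrt \<mu> \<le> \<mu>"
        using mu1 by (intro real_le_lsqrt) (auto simp: power2_eq_square)
      then have "132 / \<mu> \<le> 132 / sqrt \<mu>"
        using mu1 by (intro divide_left_mono) auto
      moreover have "sqrt 2 / sqrt \<mu> \<le> 2 / sqrt \<mu>"
        using mu1 by (intro divide_right_mono) (auto intro: real_le_lsqrt)
      ultimately show "sqrt 2 / sqrt \<mu> + 132 / \<mu> \<le> 134 / sqrt \<mu>"
        by (simp add: add_divide_distrib[symmetric])
    qed simp
    also have "\<dots> \<le> fact n * (134 / sqrt (\<delta> * n))"
      using mu_lower n4 \<delta> n0 mu1 by (intro mult_left_mono divide_left_mono) auto
    also have "\<dots> = fact n * (134 / sqrt \<delta> / sqrt n)"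
      by (simp add: real_sqrt_mult)
    finally show ?thesis by (simp add: Q_def n_def \<delta>_def)
  qed
qed

section \<open>Multiplicities and the probability statement\<close>

text \<open>The maximum runs over infinitely many reals, but all counts lie in \<open>{..n}\<close>,
  so the range is finite and \<open>Max\<close> is an upper bound.\<close>

lemma card_le_max_mult: "card {i \<in> {1..n}. v i = z} \<le> max_mult n v"
proof -
  have "card {i \<in> {1..n}. v i = a} \<le> n" for a
    using card_mono[of "{1..n}" "{i \<in> {1..n}. v i = a}"] by (simp only: finite_atLeastAtMost card_atLeastAtMost Collect_restrict) simp
  then have "range (\<lambda>a. card {i \<in> {1..n}. v i = a}) \<subseteq> {..n}" by blast
  then have "finite (range (\<lambda>a. card {i \<in> {1..n}. v i = a}))"
    by (rule finite_subset) simp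
  then show ?thesis unfolding max_mult_def by (intro Max_ge) auto
qed

theorem corollary3p1:
  fixes c :: real
  assumes "0 < c" and "c < 1"
  shows "\<exists>K :: real. \<forall>n \<ge> (1 :: nat). \<forall>(w :: nat \<Rightarrow> real) (v :: nat \<Rightarrow> real).
           real (max_mult n w) \<le> c * real n \<longrightarrow> real (max_mult n v) \<le> c * real n \<longrightarrow>
           (SUP x :: real. measure_pmf.prob (random_perm n) {\<pi>. (\<Sum>i = 1..n. w i * v (\<pi> i)) = x})
             \<le> K / sqrt (real n)"
proof (intro exI allI impI)
  fix n :: nat and w v :: "nat \<Rightarrow> real"
  assume n: "1 \<le> n"
    and w: "real (max_mult n w) \<le> c * real n" and v: "real (max_mult n v) \<le> c * real n"
  \<comment> \<open>This fixes the witness \<open>K\<close> left open by \<open>exI\<close>; it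
    depends on \<open>c\<close> alone. A bound for each \<open>x\<close> separately then bounds the
    supremum.\<close>
  show "(SUP x :: real. measure_pmf.prob (random_perm n) {\<pi>. (\<Sum>i = 1..n. w i * v (\<pi> i)) = x})
      \<le> 134 / sqrt ((1 - c)\<^sup>2 / 2) / sqrt (real n)"
  proof (rule cSUP_least)
    fix x
    define P where "P = {\<pi>. \<pi> permutes {1..n}}"
    have P: "P \<noteq> {}" "finite P" "card P = fact n"
      using permutes_id[of "{1..n}"] unfolding P_def by (blast, simp_all add: finite_permutations card_permutations)
    have "measure_pmf.prob (random_perm n) {\<pi>. (\<Sum>i = 1..n. w i * v (\<pi> i)) = x}
        = real (card {\<pi>. \<pi> permutes {1..n} \<and> (\<Sum>i = 1..n. w i * v (\<pi> i)) = x}) / fact n"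
      unfolding random_perm_def P_def[symmetric] using P
      by (simp add: measure_pmf_of_set Int_def P_def)
    also have "\<dots> \<le> 134 / sqrt ((1 - c)\<^sup>2 / 2) / sqrt (real n)"
    proof -
      have "real (card {i \<in> {1..n}. u i = z}) \<le> c * real (card {1..n})"
        if "real (max_mult n u) \<le> c * real n" for u z
        using of_nat_mono[OF card_le_max_mult[of n u z], where 'a = real] that by simp
      then have "real (card {\<pi>. \<pi> permutes {1..n} \<and> (\<Sum>i = 1..n. w i * v (\<pi> i)) = x})
          \<le> fact n * (134 / sqrt ((1 - c)\<^sup>2 / 2) / sqrt (real n))"
        using card_perm_sum_bound[of c "{1..n}" w v x] assms n w v by simp
      then show ?thesis by (simp add: field_simps)
    qed
    finally show "measure_pmf.prob (random_perm n) {\<pi>. (\<Sum>i = 1..n. w i * v (\<pi> i)) = x}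
        \<le> 134 / sqrt ((1 - c)\<^sup>2 / 2) / sqrt (real n)" .
  qed simp
qed

end
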